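(* Let $G$ be a finite bipartite graph of order $n$ (i.e. with $n$ vertices) without isolated vertices. Then $\gamma(G)=\gamma^{\infty}(G)$ if and only if $\gamma(G)=n/2$.
   Context: All graphs are finite, simple and undirected. A dominating set of $G=(V,E)$ is a set $D\subseteq V$ such that every vertex of $V-D$ is adjacent to a vertex of $D$; $\gamma(G)$ is the minimum size of a dominating set. Eternal domination ("one guard moves"): a defender chooses a set $D_1\subseteq V$ and places one guard on each vertex of $D_1$. Then, for $i=1,2,\ldots$ in turn, an attacker (knowing the current position) chooses a vertex $r_i\in V-D_i$, and the defender responds by moving exactly one guard to $r_i$ from an adjacent vertex $v\in D_i$, so that $D_{i+1}=(D_i-\{v\})\cup\{r_i\}$. Every $D_i$ must be a dominating set. $D_1$ is an eternal dominating set (EDS) if the defender, starting from $D_1$, can respond in this way forever to every infinite sequence of attacks. The eternal domination number $\gamma^{\infty}(G)$ is the minimum size of an EDS of $G$. *)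

theory Defs
  imports Complex_Main "Graph_Theory.Graph_Theory"
begin

text \<open>
  Finite simple undirected graphs are the symmetric, loop-free finite digraphs of locale
  \<^locale>\<open>pair_graph\<close>: each undirected edge is represented by its two arcs in \<^term>\<open>parcs G\<close>.
\<close>

definition bipartite :: "'a pair_pre_digraph \<Rightarrow> bool" where
  "bipartite G \<longleftrightarrow> (\<exists>A B. A \<union> B = pverts G \<and> A \<inter> B = {} \<and>
     (\<forall>(u, v)\<in>parcs G. u \<in> A \<and> v \<in> B \<or> u \<in> B \<and> v \<in> A))"

definition isolated_vertex :: "'a pair_pre_digraph \<Rightarrow> 'a \<Rightarrow> bool" where
  "isolated_vertex G v \<longleftrightarrow> v \<in> pverts G \<and> (\<forall>u. (u, v) \<notin> parcs G)"

definition dominating_set :: "'a pair_pre_digraph \<Rightarrow> 'a set \<Rightarrow> bool" where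
  "dominating_set G D \<longleftrightarrow> D \<subseteq> pverts G \<and> (\<forall>v\<in>pverts G - D. \<exists>u\<in>D. (u, v) \<in> parcs G)"

definition domination_number :: "'a pair_pre_digraph \<Rightarrow> nat" where
  "domination_number G = Min (card ` {D. dominating_set G D})"

text \<open>
  A strategy of the defender maps the nonempty list of attacks made so far, in chronological
  order and including the current one, to the vertex whose guard moves; being fixed before the
  attacks are quantified over, it cannot depend on future attacks. Attacks and positions are
  numbered from 0, so \<open>guards \<sigma> D r 0 = D\<close> is the initial position.
\<close>

primrec guards :: "('a list \<Rightarrow> 'a) \<Rightarrow> 'a set \<Rightarrow> (nat \<Rightarrow> 'a) \<Rightarrow> nat \<Rightarrow> 'a set" where
  "guards \<sigma> D r 0 = D"
| "guards \<sigma> D r (Suc i) = (guards \<sigma> D r i - {\<sigma> (map r [0..<Suc i])}) \<union> {r i}"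

text \<open>
  The positions and replies up to step \<open>i\<close> are constrained as soon as the attacks before (and, for
  the reply, at) step \<open>i\<close> are legal. Demanding legality of all infinitely many attacks as a premise
  would let a defender win by an illegal reply that leaves the attacker without a legal attack.
\<close>

definition eternal_dominating_set :: "'a pair_pre_digraph \<Rightarrow> 'a set \<Rightarrow> bool" where
  "eternal_dominating_set G D \<longleftrightarrow> D \<subseteq> pverts G \<and>
     (\<exists>\<sigma>. \<forall>r i. (\<forall>j<i. r j \<in> pverts G - guards \<sigma> D r j) \<longrightarrow>
        dominating_set G (guards \<sigma> D r i) \<and>
        (r i \<in> pverts G - guards \<sigma> D r i \<longrightarrow>
           \<sigma> (map r [0..<Suc i]) \<in> guards \<sigma> D r i \<and>
           (\<sigma> (map r [0..<Suc i]), r i) \<in> parcs G))"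

definition eternal_domination_number :: "'a pair_pre_digraph \<Rightarrow> nat" where
  "eternal_domination_number G = Min (card ` {D. eternal_dominating_set G D})"

end

theory Submission
  imports Defs
begin

text \<open>
  Let \<open>A\<close>, \<open>B\<close> be the colour classes. Without isolated vertices each of them is dominating, so
  \<open>\<gamma> \<le> min |A| |B| \<le> n/2\<close>. An attacker who only attacks vertices of an independent set \<open>I\<close>
  forces one more guard onto \<open>I\<close> with each attack, so \<open>\<gamma>\<^sup>\<infinity> \<ge> |I|\<close> and hence
  \<open>\<gamma>\<^sup>\<infinity> \<ge> max |A| |B| \<ge> n/2\<close>. If \<open>\<gamma> = n/2\<close>, then \<open>|A| = |B| = n/2\<close>, and
  Hall's condition holds: for \<open>S \<subseteq> A\<close> the set \<open>(A - S) \<union> N(S)\<close> is dominating, so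
  \<open>|S| \<le> |N(S)|\<close>. In the resulting perfect matching the defender answers every attack along the
  matching edge, keeping exactly one guard on each edge.
\<close>

section \<open>Hall's theorem\<close>

text \<open>Induction over proper subsets. Either some proper nonempty \<open>S\<close> attains
  equality, and \<open>S\<close> and \<open>I - S\<close> are matched separately, or all such
  \<open>S\<close> have a value to spare and one index can be matched arbitrarily.\<close>

theorem hall_marriage:
  assumes "finite I"
    and "\<And>i. i \<in> I \<Longrightarrow> finite (N i)"
    and "\<And>S. S \<subseteq> I \<Longrightarrow> card S \<le> card (\<Union>(N ` S))"
  shows "\<exists>f. inj_on f I \<and> (\<forall>i\<in>I. f i \<in> N i)"
  using assms
proof (induction I arbitrary: N rule: finite_psubset_induct)
  case (psubset I)
  note fin = psubset.prems(1) and hall = psubset.prems(2)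
  have fin_Un: "finite (\<Union>(N ` S))" if "S \<subseteq> I" for S
    using that fin psubset.hyps by (auto intro: finite_subset)
  consider (empty) "I = {}"
    | (tight) S where "S \<subset> I" "S \<noteq> {}" "card S = card (\<Union>(N ` S))"
    | (slack) i where "i \<in> I" "\<And>S. S \<subset> I \<Longrightarrow> S \<noteq> {} \<Longrightarrow> card S < card (\<Union>(N ` S))"
    using hall by (metis ex_in_conv le_neq_implies_less psubset_imp_subset)
  then show ?case
  proof cases
    case empty
    then show ?thesis by simp
  next
    case (tight S)
    let ?U = "\<Union>(N ` S)"
    have "\<exists>f. inj_on f S \<and> (\<forall>i\<in>S. f i \<in> N i)"
      using tight(1) fin hall by (intro psubset.IH) auto
    then obtain f where f: "inj_on f S" "\<And>i. i \<in> S \<Longrightarrow> f i \<in> N i" by blast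
    have "\<exists>g. inj_on g (I - S) \<and> (\<forall>i\<in>I - S. g i \<in> N i - ?U)"
    proof (rule psubset.IH)
      show "I - S \<subset> I" using tight by blast
      show "finite (N i - ?U)" if "i \<in> I - S" for i using that fin by blast
      fix T assume T: "T \<subseteq> I - S"
      \<comment> \<open>Hall's condition for \<open>S \<union> T\<close>, with
        \<open>card S = card ?U\<close> cancelled, shows that enough values outside
        \<open>?U\<close> remain for \<open>T\<close>.\<close>
      have "card S + card T = card (S \<union> T)"
        using T tight(1) psubset.hyps by (subst card_Un_disjoint) (auto intro: finite_subset)
      also have "\<dots> \<le> card (\<Union>(N ` (S \<union> T)))"
        using T tight(1) by (intro hall) blast
      also have "\<Union>(N ` (S \<union> T)) = ?U \<union> (\<Union>i\<in>T. N i - ?U)" by auto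
      also have "card \<dots> \<le> card ?U + card (\<Union>i\<in>T. N i - ?U)" by (rule card_Un_le)
      finally show "card T \<le> card (\<Union>i\<in>T. N i - ?U)" using tight(3) by simp
    qed
    then obtain g where g: "inj_on g (I - S)" "\<And>i. i \<in> I - S \<Longrightarrow> g i \<in> N i - ?U" by blast
    have "inj_on (\<lambda>i. if i \<in> S then f i else g i) I"
    proof (rule inj_onI)
      fix i j
      assume "i \<in> I" "j \<in> I" "(if i \<in> S then f i else g i) = (if j \<in> S then f j else g j)"
      then show "i = j"
        using inj_onD[OF f(1), of i j] inj_onD[OF g(1), of i j] f(2)[of i] f(2)[of j]
          g(2)[of i] g(2)[of j] by (auto split: if_splits)
    qed
    then show ?thesis
      using f(2) g(2) by (intro exI[of _ "\<lambda>i. if i \<in> S then f i else g i"]) auto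
  next
    case (slack i)
    have "card {i} \<le> card (\<Union>(N ` {i}))" using slack(1) by (intro hall) blast
    then obtain x where x: "x \<in> N i" by fastforce
    have "\<exists>g. inj_on g (I - {i}) \<and> (\<forall>j\<in>I - {i}. g j \<in> N j - {x})"
    proof (rule psubset.IH)
      show "I - {i} \<subset> I" using slack by blast
      show "finite (N j - {x})" if "j \<in> I - {i}" for j using that fin by blast
      fix T assume T: "T \<subseteq> I - {i}"
      show "card T \<le> card (\<Union>j\<in>T. N j - {x})"
      proof (cases "T = {}")
        case False
        \<comment> \<open>Removing \<open>x\<close> costs at most one value, which the strict
          inequality covers.\<close>
        have "(\<Union>j\<in>T. N j - {x}) = \<Union>(N ` T) - {x}" by blast
        moreover have "card T < card (\<Union>(N ` T))" using T False slack by blast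
        ultimately show ?thesis by (auto simp: card_Diff_singleton_if)
      qed simp
    qed
    then obtain g where "inj_on g (I - {i})" "\<And>j. j \<in> I - {i} \<Longrightarrow> g j \<in> N j - {x}" by blast
    then have "inj_on (g(i := x)) I \<and> (\<forall>j\<in>I. (g(i := x)) j \<in> N j)"
      using x by (auto simp: inj_on_def)
    then show ?thesis by blast
  qed
qed

section \<open>Eternal domination\<close>

text \<open>Allows an adaptive attacker: redefining the sequence at step \<open>k\<close> leaves the
  positions up to \<open>k\<close> unchanged.\<close>

lemma guards_cong:
  assumes "\<And>j. j < i \<Longrightarrow> r j = r' j"
  shows "guards \<sigma> D r i = guards \<sigma> D r' i"
  using assms
proof (induction i)
  case (Suc i)
  then have "map r [0..<Suc i] = map r' [0..<Suc i]" by (intro map_cong) auto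
  with Suc show ?case by (simp only: guards.simps)
qed simp

context pair_graph
begin

lemma finite_dominating_sets: "finite {D. dominating_set G D}"
  by (rule finite_subset[of _ "Pow (pverts G)"]) (auto simp: dominating_set_def)

lemma finite_eternal_dominating_sets: "finite {D. eternal_dominating_set G D}"
  by (rule finite_subset[of _ "Pow (pverts G)"]) (auto simp: eternal_dominating_set_def)

lemma domination_number_le: "dominating_set G D \<Longrightarrow> domination_number G \<le> card D"
  unfolding domination_number_def using finite_dominating_sets by (intro Min_le) auto

lemma eternal_domination_number_le:
  "eternal_dominating_set G D \<Longrightarrow> eternal_domination_number G \<le> card D"
  unfolding eternal_domination_number_def using finite_eternal_dominating_sets
  by (intro Min_le) auto

text \<open>Makes the set under \<open>Min\<close> nonempty. With all vertices guarded no first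
  attack is legal, so only \<open>i = 0\<close> has to be checked.\<close>

lemma eternal_dominating_set_verts: "eternal_dominating_set G (pverts G)"
proof -
  have "i = 0" if "\<forall>j<i. r j \<in> pverts G - guards \<sigma> (pverts G) r j" for \<sigma> r i
    using spec[OF that, of 0] by simp
  then show ?thesis
    unfolding eternal_dominating_set_def dominating_set_def
    by (intro conjI exI[of _ undefined] allI impI) fastforce+
qed

lemma eternal_domination_number_attained:
  "\<exists>D. eternal_dominating_set G D \<and> card D = eternal_domination_number G"
proof -
  have "eternal_domination_number G \<in> card ` {D. eternal_dominating_set G D}"
    unfolding eternal_domination_number_def
    using finite_eternal_dominating_sets eternal_dominating_set_verts by (intro Min_in) auto
  then show ?thesis by auto
qed

text \<open>A guard answering an attack inside \<open>I\<close> comes along an edge, hence from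
  outside \<open>I\<close>, so no guard leaves \<open>I\<close>. While \<open>I\<close> is larger
  than the number of guards, it has an unguarded vertex to attack.\<close>

lemma independent_card_le_eternal_dominating_set:
  assumes eds: "eternal_dominating_set G D"
    and I: "I \<subseteq> pverts G" "\<And>u v. u \<in> I \<Longrightarrow> v \<in> I \<Longrightarrow> (u, v) \<notin> parcs G"
  shows "card I \<le> card D"
proof (rule ccontr)
  assume less: "\<not> card I \<le> card D"
  obtain \<sigma> where \<sigma>: "\<And>r i. \<forall>j<i. r j \<in> pverts G - guards \<sigma> D r j \<Longrightarrow>
        dominating_set G (guards \<sigma> D r i) \<and>
        (r i \<in> pverts G - guards \<sigma> D r i \<longrightarrow>
           \<sigma> (map r [0..<Suc i]) \<in> guards \<sigma> D r i \<and>
           (\<sigma> (map r [0..<Suc i]), r i) \<in> parcs G)"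
    using eds unfolding eternal_dominating_set_def by blast
  \<comment> \<open>The sequence may depend on \<open>k\<close>: it is built one attack at a time
    against the fixed \<open>\<sigma>\<close>, and only its first \<open>k\<close> entries
    matter.\<close>
  have "\<exists>r. (\<forall>j<k. r j \<in> pverts G - guards \<sigma> D r j) \<and>
      finite (guards \<sigma> D r k) \<and> card (guards \<sigma> D r k) = card D \<and> k \<le> card (guards \<sigma> D r k \<inter> I)" for k
  proof (induction k)
    case 0
    have "finite D" using eds pair_finite_verts
      by (auto simp: eternal_dominating_set_def intro: finite_subset)
    then show ?case by simp
  next
    case (Suc k)
    then obtain r where r: "\<And>j. j < k \<Longrightarrow> r j \<in> pverts G - guards \<sigma> D r j"
      "card (guards \<sigma> D r k) = card D" "k \<le> card (guards \<sigma> D r k \<inter> I)"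
      and fin: "finite (guards \<sigma> D r k)" by blast
    let ?P = "guards \<sigma> D r k"
    obtain x where x: "x \<in> I" "x \<notin> ?P"
      using less r(2) card_mono[OF fin, of I] by auto
    define r' where "r' = r(k := x)"
    have eq: "guards \<sigma> D r' j = guards \<sigma> D r j" if "j \<le> k" for j
      using that by (intro guards_cong) (auto simp: r'_def)
    have legal: "\<forall>j<Suc k. r' j \<in> pverts G - guards \<sigma> D r' j"
      using r(1) x I(1) eq by (auto simp: less_Suc_eq) (auto simp: r'_def)
    define s where "s = \<sigma> (map r' [0..<Suc k])"
    have r'k: "r' k = x" by (simp add: r'_def)
    have "\<forall>j<k. r' j \<in> pverts G - guards \<sigma> D r' j"
      "r' k \<in> pverts G - guards \<sigma> D r' k" using legal by (blast intro: less_SucI)+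
    then have "s \<in> ?P" "(s, x) \<in> parcs G"
      using \<sigma>[of k r'] eq[of k] r'k unfolding s_def by simp_all
    then have s: "s \<in> ?P" "s \<notin> I" using x I(2) by auto
    have P': "guards \<sigma> D r' (Suc k) = insert x (?P - {s})"
      using eq[of k] r'k by (simp add: s_def)
    have "card (insert x (?P - {s})) = card D"
      using s x fin r(2) card_Suc_Diff1[OF fin s(1)] by simp
    moreover have "insert x (?P - {s}) \<inter> I = insert x (?P \<inter> I)" using s x by blast
    ultimately show ?case
      using legal P' x fin r(3) by (intro exI[of _ r']) simp
  qed
  \<comment> \<open>One attack more than there are guards puts too many guards on
    \<open>I\<close>.\<close>
  from this[of "Suc (card D)"] obtain P
    where "finite P" "card P = card D" "Suc (card D) \<le> card (P \<inter> I)" by blast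
  then show False using card_mono[of P "P \<inter> I"] by simp
qed

text \<open>The involution \<open>p\<close> is a perfect matching with one guard per edge. Replying
  along the edge preserves this, and an unguarded vertex is dominated by its partner.\<close>

lemma perfect_matching_eternal_dominating_set:
  assumes p: "\<And>v. v \<in> pverts G \<Longrightarrow> (p v, v) \<in> parcs G \<and> p (p v) = v"
    and D: "D \<subseteq> pverts G" "\<And>v. v \<in> pverts G \<Longrightarrow> p v \<in> D \<longleftrightarrow> v \<notin> D"
  shows "eternal_dominating_set G D"
proof -
  define \<sigma> where "\<sigma> = (\<lambda>xs. p (last xs))"
  have inv: "guards \<sigma> D r i \<subseteq> pverts G \<and>
      (\<forall>v\<in>pverts G. p v \<in> guards \<sigma> D r i \<longleftrightarrow> v \<notin> guards \<sigma> D r i)"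
    if "\<forall>j<i. r j \<in> pverts G - guards \<sigma> D r j" for r i
    using that
  proof (induction i)
    case 0
    then show ?case using D by simp
  next
    case (Suc i)
    have P': "guards \<sigma> D r (Suc i) = insert (r i) (guards \<sigma> D r i - {p (r i)})"
      by (simp add: \<sigma>_def)
    \<comment> \<open>These facts confine the effect of the move to the pair of \<open>r i\<close>
      and \<open>p (r i)\<close>.\<close>
    have p': "p v = r i \<longleftrightarrow> v = p (r i)" "p v = p (r i) \<longleftrightarrow> v = r i" "p v \<noteq> v"
      if "v \<in> pverts G" for v
    proof -
      show "p v = p (r i) \<longleftrightarrow> v = r i" using p[OF that] p[of "r i"] Suc.prems by (metis DiffD1 lessI)
      show "p v = r i \<longleftrightarrow> v = p (r i)" using p[OF that] p[of "r i"] Suc.prems by (metis DiffD1 lessI)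
      show "p v \<noteq> v" using D(2)[OF that] by auto
    qed
    have r: "r i \<in> pverts G" "r i \<notin> guards \<sigma> D r i" using Suc.prems by auto
    have IH: "guards \<sigma> D r i \<subseteq> pverts G"
      "\<And>v. v \<in> pverts G \<Longrightarrow> p v \<in> guards \<sigma> D r i \<longleftrightarrow> v \<notin> guards \<sigma> D r i"
      using Suc by simp_all
    show ?case unfolding P' using IH p' r by auto
  qed
  have "dominating_set G (guards \<sigma> D r i) \<and>
        (r i \<in> pverts G - guards \<sigma> D r i \<longrightarrow>
           \<sigma> (map r [0..<Suc i]) \<in> guards \<sigma> D r i \<and>
           (\<sigma> (map r [0..<Suc i]), r i) \<in> parcs G)"
    if "\<forall>j<i. r j \<in> pverts G - guards \<sigma> D r j" for r i
    using inv[OF that] p unfolding dominating_set_def \<sigma>_def by fastforce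
  then show ?thesis unfolding eternal_dominating_set_def using D(1) by blast
qed

end

section \<open>Bipartite graphs\<close>

text \<open>The classes are ordered so that bounds need proof only for \<open>A\<close>; a second
  interpretation with the classes swapped gives them for \<open>B\<close>.\<close>

locale bipartition = pair_graph G for G :: "'a pair_pre_digraph" +
  fixes A B :: "'a set"
  assumes verts: "A \<union> B = pverts G" and disj: "A \<inter> B = {}"
    and arcs: "\<And>u v. (u, v) \<in> parcs G \<Longrightarrow> u \<in> A \<and> v \<in> B \<or> u \<in> B \<and> v \<in> A"
    and no_isolated: "\<And>v. v \<in> pverts G \<Longrightarrow> \<exists>u. (u, v) \<in> parcs G"
begin

lemma arc_sym: "(u, v) \<in> parcs G \<Longrightarrow> (v, u) \<in> parcs G"
  using pair_sym_arcs by (auto simp: symmetric_def dest: symD)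

lemma finite_parts: "finite A" "finite B"
  using verts pair_finite_verts by (metis finite_Un)+

text \<open>A vertex of \<open>S\<close> has a neighbour, and that one is adjacent to
  \<open>S\<close>; a vertex of \<open>B\<close> not adjacent to \<open>S\<close> has a neighbour in
  \<open>A - S\<close>. Empty \<open>S\<close> gives \<open>A\<close> itself.\<close>

lemma dominating_set_part_exchange:
  assumes "S \<subseteq> A"
  shows "dominating_set G ((A - S) \<union> {v. \<exists>u\<in>S. (u, v) \<in> parcs G})"
  unfolding dominating_set_def
proof (intro conjI ballI)
  show "(A - S) \<union> {v. \<exists>u\<in>S. (u, v) \<in> parcs G} \<subseteq> pverts G"
    using verts in_arcsD2 by blast
  fix v assume v: "v \<in> pverts G - ((A - S) \<union> {v. \<exists>u\<in>S. (u, v) \<in> parcs G})"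
  then obtain u where "(u, v) \<in> parcs G" using no_isolated by blast
  then show "\<exists>u\<in>(A - S) \<union> {v. \<exists>u\<in>S. (u, v) \<in> parcs G}. (u, v) \<in> parcs G"
    using v verts arcs arc_sym disj assms by blast
qed

lemma card_part_le_eternal_domination_number: "card A \<le> eternal_domination_number G"
proof -
  obtain D where D: "eternal_dominating_set G D" "card D = eternal_domination_number G"
    using eternal_domination_number_attained by blast
  have "card A \<le> card D"
    using verts arcs disj by (intro independent_card_le_eternal_dominating_set[OF D(1)]) blast+
  then show ?thesis using D by simp
qed

lemma domination_number_le_part: "domination_number G \<le> card A"
  using dominating_set_part_exchange[of "{}"] domination_number_le by fastforce

text \<open>By minimality of \<open>card A\<close>, exchanging \<open>S\<close> for its
  neighbourhood cannot shrink the set, which yields Hall's condition. As the classes have equal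
  size, the matching is perfect, and \<open>A\<close> contains one end of each edge.\<close>

lemma eternal_dominating_set_part:
  assumes "card A = card B" "domination_number G = card A"
  shows "eternal_dominating_set G A"
proof -
  define N where "N u = {v. (u, v) \<in> parcs G}" for u
  have fin: "finite (N u)" for u
    by (rule finite_subset[OF _ pair_finite_verts]) (auto simp: N_def dest: in_arcsD2)
  have "card S \<le> card (\<Union>(N ` S))" if "S \<subseteq> A" for S
  proof -
    have eq: "\<Union>(N ` S) = {v. \<exists>u\<in>S. (u, v) \<in> parcs G}" by (auto simp: N_def)
    have "card A \<le> card ((A - S) \<union> \<Union>(N ` S))"
      unfolding eq using domination_number_le[OF dominating_set_part_exchange[OF that]] assms
      by simp
    also have "\<dots> \<le> card (A - S) + card (\<Union>(N ` S))" by (rule card_Un_le)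
    also have "card (A - S) = card A - card S"
      using that finite_parts by (meson card_Diff_subset finite_subset)
    finally show ?thesis using card_mono[OF finite_parts(1) that] by simp
  qed
  from hall_marriage[OF finite_parts(1) fin this]
  obtain f where f: "inj_on f A" "\<And>u. u \<in> A \<Longrightarrow> (u, f u) \<in> parcs G"
    by (auto simp: N_def)
  have "f ` A \<subseteq> B" using f(2) arcs disj by blast
  then have "f ` A = B"
    using f(1) assms(1) finite_parts by (intro card_subset_eq) (simp_all add: card_image)
  then have f_inv: "inv_into A f v \<in> A" "f (inv_into A f v) = v" if "v \<in> B" for v
    using that by (auto intro: inv_into_into f_inv_into_f)
  \<comment> \<open>The involution swapping the ends of each matching edge
    \<open>(u, f u)\<close>.\<close>
  define p where "p v = (if v \<in> A then f v else inv_into A f v)" for v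
  have p_part: "p v \<in> A \<longleftrightarrow> v \<notin> A" if "v \<in> pverts G" for v
    using that \<open>f ` A = B\<close> f_inv(1) verts disj by (auto simp: p_def)
  show ?thesis
  proof (rule perfect_matching_eternal_dominating_set[of p])
    fix v assume v: "v \<in> pverts G"
    show "p v \<in> A \<longleftrightarrow> v \<notin> A" using p_part v .
    show "(p v, v) \<in> parcs G \<and> p (p v) = v"
    proof (cases "v \<in> A")
      case True
      then show ?thesis using p_part[OF v] f arc_sym by (simp add: p_def)
    next
      case False
      then show ?thesis using p_part[OF v] v f(2) f_inv verts by (fastforce simp: p_def)
    qed
  qed (use verts in blast)
qed

end

theorem proposition4p2:
  fixes G :: "'a pair_pre_digraph" and n :: nat
  assumes "pair_graph G"
    and "bipartite G"
    and "card (pverts G) = n"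
    and "\<not> (\<exists>v. isolated_vertex G v)"
  shows "domination_number G = eternal_domination_number G \<longleftrightarrow>
         real (domination_number G) = real n / 2"
proof -
  interpret pair_graph G by fact
  from assms(2) obtain A B where AB: "A \<union> B = pverts G" "A \<inter> B = {}"
    and arcs: "\<forall>(u, v)\<in>parcs G. u \<in> A \<and> v \<in> B \<or> u \<in> B \<and> v \<in> A"
    unfolding bipartite_def by (elim exE conjE)
  interpret A: bipartition G A B
  proof unfold_locales
    show "u \<in> A \<and> v \<in> B \<or> u \<in> B \<and> v \<in> A" if "(u, v) \<in> parcs G" for u v
      using bspec[OF arcs that] by simp
    show "\<exists>u. (u, v) \<in> parcs G" if "v \<in> pverts G" for v
      using assms(4) that by (simp add: isolated_vertex_def)
  qed (fact AB)+
  interpret B: bipartition G B A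
  proof unfold_locales
    show "B \<union> A = pverts G" "B \<inter> A = {}" using AB by (simp_all add: Un_commute Int_commute)
    show "u \<in> B \<and> v \<in> A \<or> u \<in> A \<and> v \<in> B" if "(u, v) \<in> parcs G" for u v
      using A.arcs[OF that] by (simp add: disj_commute)
  qed (rule A.no_isolated)
  have n: "n = card A + card B"
    using card_Un_disjoint[OF A.finite_parts AB(2)] AB(1) assms(3) by simp
  note bounds = A.domination_number_le_part B.domination_number_le_part
    A.card_part_le_eternal_domination_number B.card_part_le_eternal_domination_number
  show ?thesis
  proof
    assume "domination_number G = eternal_domination_number G"
    \<comment> \<open>Both class sizes lie between the two numbers, so equality forces both to
      coincide with them.\<close>
    then show "real (domination_number G) = real n / 2" using bounds n by simp
  next
    assume "real (domination_number G) = real n / 2"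
    \<comment> \<open>Each class size is at least \<open>domination_number G\<close>, and together
      they sum to exactly twice it.\<close>
    then have eq: "domination_number G = card A" "card A = card B" using bounds n by linarith+
    then have "eternal_domination_number G \<le> card A"
      using A.eternal_dominating_set_part eternal_domination_number_le by blast
    then show "domination_number G = eternal_domination_number G"
      using bounds(3) eq(1) by linarith
  qed
qed

end
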